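(* Let $\mu$ be a self-affine measure on a Bedford-McMullen sponge $F\subset\mathbb{R}^d$, $d\ge2$, satisfying the very strong separation condition. Then $$\dim_{\mathrm{A}}(\mu,x)=\dim_{\mathrm{A}}\mu$$ for $\mu$-almost every $x\in F$.
   Context: Bedford-McMullen sponges. Let $d\ge2$, let $2\le n_1<n_2<\dots<n_d$ be integers and let $\Lambda\subset\prod_{q=1}^d\{0,\dots,n_q-1\}$. For $\bar\imath=(i_1,\dots,i_d)\in\Lambda$ define $\varphi_{\bar\imath}:[0,1]^d\to[0,1]^d$ by $$\varphi_{\bar\imath}(x_1,\dots,x_d)=\Big(\frac{x_1+i_1}{n_1},\dots,\frac{x_d+i_d}{n_d}\Big).$$ The limit set $F$, i.e. the unique non-empty compact set with $F=\bigcup_{\bar\imath\in\Lambda}\varphi_{\bar\imath}(F)$, is called a Bedford-McMullen sponge (carpet if $d=2$). Given $p_{\bar\imath}\in(0,1)$, $\bar\imath\in\Lambda$, with $\sum_{\bar\imath\in\Lambda}p_{\bar\imath}=1$, the self-affine measure $\mu$ is the unique Borel probability measure, fully supported on $F$, with $\mu=\sum_{\bar\imath\in\Lambda}p_{\bar\imath}\,\mu\circ\varphi_{\bar\imath}^{-1}$. Very strong separation condition (VSSC): whenever $(i_1,\dots,i_d),(j_1,\dots,j_d)\in\Lambda$ and $q\in\{1,\dots,d\}$ are such that $i_k=j_k$ for all $k=1,\dots,q-1$ and $i_q\neq j_q$, we have $|i_q-j_q|>1$. Dimensions. Balls $B(x,r)$ are closed, with center $x\in F$. The (global) Assouad dimension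 of $\mu$ is $$\dim_{\mathrm{A}}\mu=\inf\Big\{s>0:\exists C>0 \text{ such that for all } x\in F,\ 0<r<R,\ \tfrac{\mu(B(x,R))}{\mu(B(x,r))}\le C\big(\tfrac{R}{r}\big)^s\Big\},$$ and the pointwise Assouad dimension of $\mu$ at $x\in F$ is $$\dim_{\mathrm{A}}(\mu,x)=\inf\Big\{s>0:\exists C(x)>0 \text{ such that for all } 0<r<R,\ \tfrac{\mu(B(x,R))}{\mu(B(x,r))}\le C(x)\big(\tfrac{R}{r}\big)^s\Big\}.$$ *)

theory Defs
  imports "HOL-Probability.Probability"
begin

text \<open>
  The coordinates of \<open>\<real>\<^sup>d\<close> are indexed by a finite linearly ordered type \<open>'d\<close>, which plays
  the role of \<open>{1,\<dots>,d}\<close> with its usual order.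
\<close>

definition sponge_digits :: "('d::{finite,linorder} \<Rightarrow> nat) \<Rightarrow> ('d \<Rightarrow> nat) set \<Rightarrow> bool" where
  "sponge_digits n \<Lambda> \<longleftrightarrow>
     2 \<le> CARD('d) \<and> (\<forall>q. 2 \<le> n q) \<and> strict_mono n \<and> (\<forall>i\<in>\<Lambda>. \<forall>q. i q < n q)"

text \<open>The affine formula is used on all of \<open>\<real>\<^sup>d\<close>; it maps \<open>[0,1]\<^sup>d = cbox 0 1\<close> into itself.\<close>

definition sponge_map :: "('d::finite \<Rightarrow> nat) \<Rightarrow> ('d \<Rightarrow> nat) \<Rightarrow> real ^ 'd \<Rightarrow> real ^ 'd" where
  "sponge_map n i x = (\<chi> q. (x $ q + real (i q)) / real (n q))"

definition is_sponge :: "('d::finite \<Rightarrow> nat) \<Rightarrow> ('d \<Rightarrow> nat) set \<Rightarrow> (real ^ 'd) set \<Rightarrow> bool" where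
  "is_sponge n \<Lambda> F \<longleftrightarrow>
     F \<noteq> {} \<and> compact F \<and> F \<subseteq> cbox 0 1 \<and> F = (\<Union>i\<in>\<Lambda>. sponge_map n i ` F)"

definition measure_support :: "'a::topological_space measure \<Rightarrow> 'a set" where
  "measure_support \<mu> = {x. \<forall>U. open U \<and> x \<in> U \<longrightarrow> 0 < emeasure \<mu> U}"

definition is_self_affine_measure ::
  "('d::finite \<Rightarrow> nat) \<Rightarrow> ('d \<Rightarrow> nat) set \<Rightarrow> (('d \<Rightarrow> nat) \<Rightarrow> real) \<Rightarrow> (real ^ 'd) set
     \<Rightarrow> (real ^ 'd) measure \<Rightarrow> bool" where
  "is_self_affine_measure n \<Lambda> p F \<mu> \<longleftrightarrow>
     sets \<mu> = sets borel \<and> prob_space \<mu> \<and> measure_support \<mu> = F \<and>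
     (\<forall>A\<in>sets borel. measure \<mu> A = (\<Sum>i\<in>\<Lambda>. p i * measure \<mu> (sponge_map n i -` A)))"

definition very_strong_separation :: "('d::linorder \<Rightarrow> nat) set \<Rightarrow> bool" where
  "very_strong_separation \<Lambda> \<longleftrightarrow>
     (\<forall>i\<in>\<Lambda>. \<forall>j\<in>\<Lambda>. \<forall>q. (\<forall>k<q. i k = j k) \<and> i q \<noteq> j q \<longrightarrow> 1 < \<bar>int (i q) - int (j q)\<bar>)"

text \<open>The infima are taken in \<^typ>\<open>ereal\<close>, so that the infimum of the empty set is \<open>\<infinity>\<close>.\<close>

definition assouad_dim :: "'a::metric_space set \<Rightarrow> 'a measure \<Rightarrow> ereal" where
  "assouad_dim F \<mu> = Inf (ereal ` {s. 0 < s \<and> (\<exists>C>0. \<forall>x\<in>F. \<forall>r R. 0 < r \<and> r < R \<longrightarrow>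
     measure \<mu> (cball x R) / measure \<mu> (cball x r) \<le> C * (R / r) powr s)})"

definition pointwise_assouad_dim :: "'a::metric_space measure \<Rightarrow> 'a \<Rightarrow> ereal" where
  "pointwise_assouad_dim \<mu> x = Inf (ereal ` {s. 0 < s \<and> (\<exists>C>0. \<forall>r R. 0 < r \<and> r < R \<longrightarrow>
     measure \<mu> (cball x R) / measure \<mu> (cball x r) \<le> C * (R / r) powr s)})"

end

theory Submission
  imports Defs
begin

text \<open>
  By the very strong separation condition every point of \<open>F\<close> has a unique digit expansion, the
  digits are independent with law \<open>p\<close> under \<open>\<mu>\<close>, and balls are comparable to the approximate cubes
  that fix \<open>L q \<approx> log (1/r) / log (n q)\<close> digits in coordinate \<open>q\<close>. Let \<open>\<rho> q i\<close> be the quotient of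
  the \<open>p\<close>-masses of the digits agreeing with \<open>i\<close> in the coordinates \<open>< q\<close>, respectively \<open>\<le> q\<close>.
  Telescoping over \<open>q\<close>, the quotient of the measures of two concentric approximate cubes is the
  product over \<open>q\<close> of \<open>\<rho> q\<close> over the digits in the positions \<open>L q \<le> l < L' q\<close>. Hence
  \<open>D = (\<Sum>q. log (max \<rho> q) / log (n q))\<close> bounds the Assouad dimension from above. At small scales
  the position blocks of different \<open>q\<close> are disjoint, so that the digits maximising \<open>\<rho> q\<close> fill all
  these blocks with a probability that does not depend on the scale; by independence along a sparse
  sequence of scales this almost surely happens, and the pointwise dimension is at least \<open>D\<close>.
\<close>

text \<open>The complement is the union of all open null sets, and the Lindelof property reduces
  this union to a countable one.\<close>

lemma measure_support_compl_null:
  fixes M :: "'a::second_countable_topology measure"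
  assumes sets: "sets M = sets borel"
  shows "- measure_support M \<in> null_sets M"
proof -
  define \<U> where "\<U> = {U. open U \<and> emeasure M U = 0}"
  have eq: "- measure_support M = \<Union>\<U>"
    by (auto simp: measure_support_def \<U>_def zero_less_iff_neq_zero)
  obtain \<V> where V: "\<V> \<subseteq> \<U>" "countable \<V>" "\<Union>\<V> = \<Union>\<U>"
    using Lindelof[of \<U>] by (auto simp: \<U>_def)
  have "(\<Union>U\<in>\<V>. U) \<in> null_sets M"
    by (rule null_sets_UN') (use V in \<open>auto simp: \<U>_def null_sets_def sets\<close>)
  then show ?thesis using V(3) eq by simp
qed

text \<open>Swapping base and exponent turns \<open>M powr log n T\<close> into
  \<open>T powr (ln M / ln n)\<close>, so bounds by digit counts become powers of the scale
  \<open>T\<close>. The offsets \<open>e\<close> carry the rounding errors of the counts.\<close>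

lemma prod_power_log_eq:
  fixes n :: "'q \<Rightarrow> nat" and M e :: "'q \<Rightarrow> real"
  assumes "finite I" "T > 0" "\<And>q. q \<in> I \<Longrightarrow> M q > 0" "\<And>q. q \<in> I \<Longrightarrow> n q \<ge> 2"
  shows "(\<Prod>q\<in>I. M q powr (log (n q) T + e q)) =
         (\<Prod>q\<in>I. M q powr e q) * T powr (\<Sum>q\<in>I. ln (M q) / ln (n q))"
proof -
  have "M q powr (log (n q) T + e q) = M q powr e q * T powr (ln (M q) / ln (n q))"
    if "q \<in> I" for q
  proof -
    have "M q powr log (n q) T = T powr (ln (M q) / ln (n q))"
      using assms(2) assms(3)[OF that] by (simp add: powr_def log_def)
    then show ?thesis by (simp add: powr_add)
  qed
  then show ?thesis
    using assms(1,2) by (simp add: prod.distrib powr_sum)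
qed

section \<open>The sponge, its measure and the separation of its pieces\<close>

locale self_affine_sponge =
  fixes n :: "'d::{finite,linorder} \<Rightarrow> nat"
    and \<Lambda> :: "('d \<Rightarrow> nat) set"
    and p :: "('d \<Rightarrow> nat) \<Rightarrow> real"
    and F :: "(real ^ 'd::{finite,linorder}) set"
    and \<mu> :: "(real ^ 'd::{finite,linorder}) measure"
  assumes digits: "sponge_digits n \<Lambda>"
    and sponge: "is_sponge n \<Lambda> F"
    and p_pos: "\<And>i. i \<in> \<Lambda> \<Longrightarrow> 0 < p i"
    and p_sum: "(\<Sum>i\<in>\<Lambda>. p i) = 1"
    and self_affine: "is_self_affine_measure n \<Lambda> p F \<mu>"
    and vssc: "very_strong_separation \<Lambda>"
begin

lemma n_ge2: "2 \<le> n q"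
  using digits by (simp add: sponge_digits_def)

lemma n_gt1: "1 < real (n q)"
  using n_ge2[of q] by simp

lemma n_mono: "q \<le> q' \<Longrightarrow> n q \<le> n q'"
  using digits by (simp add: sponge_digits_def strict_mono_less_eq)

lemma n_strict_mono: "q < q' \<Longrightarrow> n q < n q'"
  using digits by (simp add: sponge_digits_def strict_mono_less)

lemma finite_\<Lambda>: "finite \<Lambda>"
proof (rule finite_subset)
  show "\<Lambda> \<subseteq> (\<Pi>\<^sub>E q\<in>UNIV. {..<n q})"
    using digits by (auto simp: sponge_digits_def)
qed (auto intro: finite_PiE)

lemma \<Lambda>_nonempty: "\<Lambda> \<noteq> {}"
  using p_sum by auto

lemma compact_F: "compact F" and F_cbox: "F \<subseteq> cbox 0 1" and F_eq: "F = (\<Union>i\<in>\<Lambda>. sponge_map n i ` F)"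
  using sponge unfolding is_sponge_def by blast+

lemma F_bounds: "x \<in> F \<Longrightarrow> 0 \<le> x $ q \<and> x $ q \<le> 1"
  using subsetD[OF F_cbox, of x] by (simp add: mem_box_cart)

lemma sets_\<mu> [simp, measurable_cong]: "sets \<mu> = sets borel"
  and prob_space_\<mu>: "prob_space \<mu>"
  and support_\<mu>: "measure_support \<mu> = F"
  and measure_self_affine:
    "A \<in> sets borel \<Longrightarrow> measure \<mu> A = (\<Sum>i\<in>\<Lambda>. p i * measure \<mu> (sponge_map n i -` A))"
  using self_affine unfolding is_self_affine_measure_def by blast+

sublocale prob_space \<mu> by (rule prob_space_\<mu>)

lemma borel_F: "F \<in> sets borel"
  using compact_F by (simp add: borel_compact)

lemma AE_F: "AE x in \<mu>. x \<in> F"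
proof -
  have "- F \<in> null_sets \<mu>"
    using measure_support_compl_null[OF sets_\<mu>] by (simp add: support_\<mu>)
  then show ?thesis by (rule AE_I') auto
qed

lemma measure_F: "measure \<mu> F = 1"
  using AE_F borel_F by (subst prob_eq_1) auto

lemma measure_Int_F:
  assumes "A \<in> sets borel"
  shows "measure \<mu> A = measure \<mu> (A \<inter> F)"
  using AE_F assms borel_F by (intro finite_measure_eq_AE) auto

lemma measure_mono_F:
  assumes "A \<inter> F \<subseteq> B" "A \<in> sets borel" "B \<in> sets borel"
  shows "measure \<mu> A \<le> measure \<mu> B"
  using assms by (subst measure_Int_F[OF assms(2)]) (auto intro!: finite_measure_mono)

text \<open>The separation condition applies at the least coordinate where \<open>i\<close> and
  \<open>j\<close> differ. The bound \<open>q \<le> q0\<close> matters later: an antitone level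
  function that constrains \<open>q0\<close> at some position constrains \<open>q\<close> there as
  well.\<close>

lemma first_difference:
  assumes "i \<in> \<Lambda>" "j \<in> \<Lambda>" "i q0 \<noteq> j q0"
  obtains q where "q \<le> q0" "i q \<noteq> j q" "1 < \<bar>int (i q) - int (j q)\<bar>"
proof -
  define D where "D = {q. i q \<noteq> j q}"
  have D: "finite D" "q0 \<in> D" using assms by (auto simp: D_def)
  then have "Min D \<in> D" by (intro Min_in) auto
  moreover have "i k = j k" if "k < Min D" for k
  proof -
    have "k \<notin> D" using that Min_le[OF D(1), of k] by (meson leD)
    then show ?thesis by (simp add: D_def)
  qed
  ultimately have "1 < \<bar>int (i (Min D)) - int (j (Min D))\<bar>"
    using vssc assms unfolding very_strong_separation_def D_def by blast
  with \<open>Min D \<in> D\<close> show thesis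
    using D by (intro that[of "Min D"]) (auto simp: D_def)
qed

text \<open>Digits that differ by more than 1 differ by at least 2, and two coordinates in the unit
  interval can take back at most 1 of this.\<close>

lemma digit_separation:
  assumes "i \<in> \<Lambda>" "j \<in> \<Lambda>" "x \<in> F" "y \<in> F" "1 < \<bar>int (i q) - int (j q)\<bar>"
  shows "1 \<le> \<bar>(x $ q + i q) - (y $ q + j q)\<bar>"
proof -
  have "2 \<le> \<bar>int (i q) - int (j q)\<bar>" using assms(5) by simp
  then have "2 \<le> \<bar>real (i q) - real (j q)\<bar>" by linarith
  then show ?thesis using F_bounds[OF assms(3), of q] F_bounds[OF assms(4), of q] by linarith
qed

lemma sponge_map_inj:
  assumes "i \<in> \<Lambda>" "j \<in> \<Lambda>" "x \<in> F" "y \<in> F" "sponge_map n i x = sponge_map n j y"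
  shows "i = j"
proof (rule ccontr)
  assume "i \<noteq> j"
  then obtain q0 where "i q0 \<noteq> j q0" by auto
  then obtain q where q: "1 < \<bar>int (i q) - int (j q)\<bar>"
    using first_difference assms by metis
  have "sponge_map n i x $ q = sponge_map n j y $ q" using assms by simp
  then have "x $ q + i q = y $ q + j q"
    using n_gt1[of q] by (simp add: sponge_map_def)
  with digit_separation[OF assms(1-4) q] show False by simp
qed

subsection \<open>Digit expansions\<close>

text \<open>\<open>THE\<close> is meaningful for \<open>x\<close> in \<open>F\<close>, where
  \<open>sponge_map_inj\<close> makes the first-level piece containing \<open>x\<close>
  unique.\<close>

definition first_digit :: "real ^ 'd::{finite,linorder} \<Rightarrow> 'd \<Rightarrow> nat" where
  "first_digit x = (THE i. i \<in> \<Lambda> \<and> x \<in> sponge_map n i ` F)"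

text \<open>The expanding map of the sponge, which undoes every \<open>sponge_map n i\<close> on its
  piece.\<close>

definition shift :: "real ^ 'd::{finite,linorder} \<Rightarrow> real ^ 'd::{finite,linorder}" where
  "shift x = (\<chi> q. n q * x $ q - first_digit x q)"

definition digit :: "nat \<Rightarrow> real ^ 'd::{finite,linorder} \<Rightarrow> 'd \<Rightarrow> nat" where
  "digit l x = first_digit ((shift ^^ l) x)"

lemma sponge_map_in_F: "i \<in> \<Lambda> \<Longrightarrow> x \<in> F \<Longrightarrow> sponge_map n i x \<in> F"
  using equalityD2[OF F_eq] by blast

lemma first_digit_sponge_map:
  "i \<in> \<Lambda> \<Longrightarrow> x \<in> F \<Longrightarrow> first_digit (sponge_map n i x) = i"
  unfolding first_digit_def by (rule the_equality) (auto dest: sponge_map_inj)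

lemma shift_sponge_map:
  assumes "i \<in> \<Lambda>" "x \<in> F" shows "shift (sponge_map n i x) = x"
proof -
  have "real (n q) \<noteq> 0" for q using n_gt1[of q] by simp
  then show ?thesis
    unfolding shift_def first_digit_sponge_map[OF assms] by (simp add: sponge_map_def vec_eq_iff)
qed

lemma F_cases:
  assumes "x \<in> F" obtains i y where "i \<in> \<Lambda>" "y \<in> F" "x = sponge_map n i y"
  using assms equalityD1[OF F_eq] by blast

lemma first_digit_in: "x \<in> F \<Longrightarrow> first_digit x \<in> \<Lambda>"
  by (erule F_cases) (simp add: first_digit_sponge_map)

lemma shift_in: "x \<in> F \<Longrightarrow> shift x \<in> F"
  by (erule F_cases) (simp add: shift_sponge_map)

lemma funpow_shift_in: "x \<in> F \<Longrightarrow> (shift ^^ l) x \<in> F"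
  by (induction l) (auto intro: shift_in)

lemma digit_in: "x \<in> F \<Longrightarrow> digit l x \<in> \<Lambda>"
  unfolding digit_def by (intro first_digit_in funpow_shift_in)

lemma digit_0_sponge_map: "i \<in> \<Lambda> \<Longrightarrow> x \<in> F \<Longrightarrow> digit 0 (sponge_map n i x) = i"
  by (simp add: digit_def first_digit_sponge_map)

lemma digit_Suc_sponge_map:
  "i \<in> \<Lambda> \<Longrightarrow> x \<in> F \<Longrightarrow> digit (Suc l) (sponge_map n i x) = digit l x"
  by (simp add: digit_def funpow_Suc_right shift_sponge_map del: funpow.simps)

lemma continuous_sponge_map: "continuous_on A (sponge_map n i)"
  unfolding sponge_map_def divide_inverse by (intro continuous_intros)

text \<open>Prepending a digit turns the set at position \<open>l\<close> into a finite union of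
  continuous images at position \<open>Suc l\<close>. Compactness is what later gives measurability
  of digit events.\<close>

lemma compact_digit_set: "compact {x \<in> F. digit l x = i}"
proof (induction l)
  case 0
  have "{x \<in> F. digit 0 x = i} = (if i \<in> \<Lambda> then sponge_map n i ` F else {})"
    by (subst F_eq) (auto simp: sponge_map_in_F digit_0_sponge_map)
  then show ?case
    by (auto intro: compact_continuous_image continuous_sponge_map compact_F)
next
  case (Suc l)
  have "{x \<in> F. digit (Suc l) x = i} = (\<Union>j\<in>\<Lambda>. sponge_map n j ` {x \<in> F. digit l x = i})"
    by (subst F_eq) (auto simp: sponge_map_in_F digit_Suc_sponge_map)
  then show ?case
    by (auto intro!: compact_UN finite_\<Lambda> compact_continuous_image continuous_sponge_map Suc)
qed

lemma borel_digit_set: "{x \<in> F. P (digit l x)} \<in> sets borel"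
proof -
  have "{x \<in> F. P (digit l x)} = (\<Union>i\<in>{i\<in>\<Lambda>. P i}. {x \<in> F. digit l x = i})"
    by (auto simp: digit_in)
  also have "\<dots> \<in> sets borel"
    using finite_\<Lambda> by (intro sets.finite_UN) (auto intro: borel_compact compact_digit_set)
  finally show ?thesis .
qed

lemma borel_digits_set: "{x \<in> F. \<forall>l<N. P l (digit l x)} \<in> sets borel" for N :: nat
proof -
  have "{x \<in> F. \<forall>l<N. P l (digit l x)} = F \<inter> (\<Inter>l\<in>{..<N}. {x \<in> F. P l (digit l x)} \<union> - F)"
    by auto
  also have "\<dots> \<in> sets borel"
    by (cases "N = 0") (auto intro!: sets.Int sets.finite_INT sets.Un borel_F borel_digit_set borel_comp)
  finally show ?thesis .
qed

text \<open>Independence of the digits. Self-affinity peels off position 0: within \<open>F\<close>,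
  the preimage of the event under \<open>sponge_map n i\<close> is empty or the event with shifted
  constraints, hence the induction over arbitrary \<open>A\<close>.\<close>

lemma measure_digits:
  "measure \<mu> {x \<in> F. \<forall>l<N. digit l x \<in> A l} = (\<Prod>l<N. sum p (\<Lambda> \<inter> A l))" for N :: nat
proof (induction N arbitrary: A)
  case 0
  then show ?case by (simp add: measure_F)
next
  case (Suc N)
  let ?E = "{x \<in> F. \<forall>l<Suc N. digit l x \<in> A l}"
  let ?E' = "{x \<in> F. \<forall>l<N. digit l x \<in> A (Suc l)}"
  have *: "measure \<mu> (sponge_map n i -` ?E) = (if i \<in> A 0 then measure \<mu> ?E' else 0)"
    if i: "i \<in> \<Lambda>" for i
  proof -
    have "sponge_map n i -` ?E \<inter> F = (if i \<in> A 0 then ?E' else {})"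
      using i by (auto simp: sponge_map_in_F digit_0_sponge_map digit_Suc_sponge_map All_less_Suc2)
    moreover have "sponge_map n i -` ?E \<in> sets borel"
      using measurable_sets[OF borel_measurable_continuous_onI[OF continuous_sponge_map] borel_digits_set]
      by simp
    ultimately show ?thesis using measure_Int_F[of "sponge_map n i -` ?E"] by simp
  qed
  have "measure \<mu> ?E = (\<Sum>i\<in>\<Lambda>. p i * measure \<mu> (sponge_map n i -` ?E))"
    by (intro measure_self_affine borel_digits_set)
  also have "\<dots> = (\<Sum>i\<in>\<Lambda>. if i \<in> A 0 then p i * measure \<mu> ?E' else 0)"
    by (intro sum.cong refl) (simp only: *, simp)
  also have "\<dots> = sum p (\<Lambda> \<inter> A 0) * measure \<mu> ?E'"
    by (simp only: sum.inter_restrict[OF finite_\<Lambda>, symmetric] sum_distrib_right)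
  also have "\<dots> = (\<Prod>l<Suc N. sum p (\<Lambda> \<inter> A l))"
    by (simp only: Suc.IH[of "\<lambda>l. A (Suc l)"] prod.lessThan_Suc_shift)
  finally show ?case .
qed

lemma borel_digits_pattern:
  assumes "finite S" shows "{x \<in> F. \<forall>l\<in>S. digit l x = w l} \<in> sets borel"
proof -
  obtain N where N: "S \<subseteq> {..<N}" using assms finite_nat_iff_bounded by blast
  have "{x \<in> F. \<forall>l\<in>S. digit l x = w l} = {x \<in> F. \<forall>l<N. l \<in> S \<longrightarrow> digit l x = w l}"
    using N by auto
  also have "\<dots> \<in> sets borel" by (rule borel_digits_set)
  finally show ?thesis .
qed

text \<open>Positions outside \<open>S\<close> are allowed all of \<Lambda>, whose mass is 1, so
  they contribute trivial factors.\<close>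

lemma measure_digits_pattern:
  assumes "finite S" "\<And>l. l \<in> S \<Longrightarrow> w l \<in> \<Lambda>"
  shows "measure \<mu> {x \<in> F. \<forall>l\<in>S. digit l x = w l} = (\<Prod>l\<in>S. p (w l))"
proof -
  obtain N where N: "S \<subseteq> {..<N}" using assms finite_nat_iff_bounded by blast
  have "{x \<in> F. \<forall>l\<in>S. digit l x = w l} = {x \<in> F. \<forall>l<N. digit l x \<in> {i. l \<in> S \<longrightarrow> i = w l}}"
    using N by auto
  also have "measure \<mu> \<dots> = (\<Prod>l<N. sum p (\<Lambda> \<inter> {i. l \<in> S \<longrightarrow> i = w l}))"
    by (rule measure_digits)
  also have "\<dots> = (\<Prod>l<N. if l \<in> S then p (w l) else 1)"
  proof (intro prod.cong refl)
    fix l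
    have "\<Lambda> \<inter> {i. l \<in> S \<longrightarrow> i = w l} = (if l \<in> S then {w l} else \<Lambda>)"
      using assms by auto
    then show "sum p (\<Lambda> \<inter> {i. l \<in> S \<longrightarrow> i = w l}) = (if l \<in> S then p (w l) else 1)"
      by (simp add: p_sum)
  qed
  also have "\<dots> = (\<Prod>l\<in>S. p (w l))"
    using N prod.inter_restrict[of "{..<N}" "\<lambda>l. p (w l)" S] by (simp add: Int_absorb1)
  finally show ?thesis .
qed

lemma measure_digit_blocks:
  assumes "finite Z" and fin: "\<And>z. z \<in> Z \<Longrightarrow> finite (I z)" and disj: "disjoint_family_on I Z"
    and a: "\<And>z. z \<in> Z \<Longrightarrow> a z \<in> \<Lambda>"
  shows "measure \<mu> {x \<in> F. \<forall>z\<in>Z. \<forall>l\<in>I z. digit l x = a z} = (\<Prod>z\<in>Z. p (a z) ^ card (I z))"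
proof -
  \<comment> \<open>Disjointness makes the block containing \<open>l\<close> unique, so the blocks
    merge into one prescribed digit sequence.\<close>
  define w where "w l = a (SOME z. z \<in> Z \<and> l \<in> I z)" for l
  have w: "w l = a z" if "z \<in> Z" "l \<in> I z" for z l
  proof -
    have "(SOME z. z \<in> Z \<and> l \<in> I z) = z"
      using that disj by (intro some_equality) (auto simp: disjoint_family_on_def)
    then show ?thesis by (simp add: w_def)
  qed
  have "{x \<in> F. \<forall>z\<in>Z. \<forall>l\<in>I z. digit l x = a z} = {x \<in> F. \<forall>l\<in>(\<Union>z\<in>Z. I z). digit l x = w l}"
    using w by auto
  also have "measure \<mu> \<dots> = (\<Prod>l\<in>(\<Union>z\<in>Z. I z). p (w l))"
    using assms w by (intro measure_digits_pattern) auto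
  also have "\<dots> = (\<Prod>z\<in>Z. \<Prod>l\<in>I z. p (w l))"
    using assms by (intro prod.UNION_disjoint) (auto simp: disjoint_family_on_def)
  also have "\<dots> = (\<Prod>z\<in>Z. p (a z) ^ card (I z))"
    by (intro prod.cong refl) (simp add: w)
  finally show ?thesis .
qed

subsection \<open>Approximate cubes\<close>

text \<open>The reciprocal of a conditional probability: that a \<open>p\<close>-random digit agrees
  with \<open>i\<close> in coordinate \<open>q\<close>, given that it does so in all earlier
  coordinates.\<close>

definition prefix_ratio :: "'d \<Rightarrow> ('d \<Rightarrow> nat) \<Rightarrow> real" where
  "prefix_ratio q i =
     sum p {j \<in> \<Lambda>. \<forall>k<q. j k = i k} / sum p {j \<in> \<Lambda>. \<forall>k\<le>q. j k = i k}"

lemma prefix_sum_pos: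
  assumes "i \<in> \<Lambda>" shows "0 < sum p {j \<in> \<Lambda>. \<forall>k\<in>K. j k = i k}"
  using assms by (intro sum_pos) (auto simp: p_pos finite_\<Lambda>)

lemma prefix_ratio_ge1:
  assumes "i \<in> \<Lambda>" shows "1 \<le> prefix_ratio q i"
proof -
  have "sum p {j \<in> \<Lambda>. \<forall>k\<le>q. j k = i k} \<le> sum p {j \<in> \<Lambda>. \<forall>k<q. j k = i k}"
    using finite_\<Lambda> by (intro sum_mono2) (auto intro: less_imp_le p_pos)
  moreover have "0 < sum p {j \<in> \<Lambda>. \<forall>k\<le>q. j k = i k}"
    using prefix_sum_pos[OF assms, of "{..q}"] by (simp add: Ball_def)
  ultimately show ?thesis by (simp add: prefix_ratio_def)
qed

text \<open>The chain rule for conditional probabilities. \<open>K\<close> must be an initial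
  segment because each factor conditions on all earlier coordinates.\<close>

lemma prefix_sum_eq:
  assumes i: "i \<in> \<Lambda>" and down: "\<And>k q. q \<in> K \<Longrightarrow> k \<le> q \<Longrightarrow> k \<in> K"
  shows "sum p {j \<in> \<Lambda>. \<forall>k\<in>K. j k = i k} = (\<Prod>q\<in>K. 1 / prefix_ratio q i)"
  using finite[of K] down
proof (induction K rule: finite_linorder_max_induct)
  case empty
  then show ?case by (simp add: p_sum)
next
  case (insert b K)
  \<comment> \<open>The inserted \<open>b\<close> lies above all of \<open>K\<close>, so downward
    closure forces \<open>K\<close> to consist of everything below \<open>b\<close>.\<close>
  have "a \<in> K" if "a < b" for a
    using insert.prems[of b a, OF _ less_imp_le[OF that]] that by auto
  then have K: "K = {..<b}" using insert.hyps(2) by auto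
  have bK: "insert b {..<b} = {..b}" by auto
  have "sum p {j \<in> \<Lambda>. \<forall>k\<in>K. j k = i k} = (\<Prod>q\<in>K. 1 / prefix_ratio q i)"
    using K by (intro insert.IH) auto
  moreover have "sum p {j \<in> \<Lambda>. \<forall>k\<in>insert b K. j k = i k} =
      sum p {j \<in> \<Lambda>. \<forall>k\<in>K. j k = i k} * (1 / prefix_ratio b i)"
    using prefix_sum_pos[OF i, of "{..<b}"] unfolding K bK prefix_ratio_def by (simp add: Ball_def del: insert_iff)
  ultimately show ?case using K by simp
qed

definition approx_cube :: "real ^ 'd::{finite,linorder} \<Rightarrow> ('d \<Rightarrow> nat) \<Rightarrow> (real ^ 'd::{finite,linorder}) set" where
  "approx_cube x L = {y \<in> F. \<forall>q. \<forall>l<L q. digit l y q = digit l x q}"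

lemma approx_cube_eq:
  assumes "\<And>q. L q \<le> N"
  shows "approx_cube x L = {y \<in> F. \<forall>l<N. digit l y \<in> {j. \<forall>q\<in>{q. l < L q}. j q = digit l x q}}"
proof -
  have "l < N" if "l < L q" for l q using that assms[of q] by simp
  then show ?thesis by (auto simp: approx_cube_def)
qed

lemma levels_bounded:
  fixes L :: "'d \<Rightarrow> nat" obtains N where "\<And>q. L q \<le> N"
  using that[of "Max (range L)"] by simp

lemma borel_approx_cube: "approx_cube x L \<in> sets borel"
proof -
  obtain N where N: "\<And>q. L q \<le> N" using levels_bounded[of L] by blast
  show ?thesis unfolding approx_cube_eq[of L N x, OF N] by (rule borel_digits_set)
qed

text \<open>At position \<open>l\<close> the constrained coordinates are those with
  \<open>l < L q\<close>. They form an initial segment since \<open>L\<close> is antitone, so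
  \<open>prefix_sum_eq\<close> applies, and the products over positions and coordinates are then
  exchanged.\<close>

lemma measure_approx_cube:
  assumes x: "x \<in> F" and L: "antimono L"
  shows "measure \<mu> (approx_cube x L) = (\<Prod>q\<in>UNIV. \<Prod>l<L q. 1 / prefix_ratio q (digit l x))"
proof -
  obtain N where N: "\<And>q. L q \<le> N" using levels_bounded[of L] by blast
  have "measure \<mu> (approx_cube x L) =
      (\<Prod>l<N. sum p (\<Lambda> \<inter> {j. \<forall>q\<in>{q. l < L q}. j q = digit l x q}))"
    unfolding approx_cube_eq[of L N x, OF N] by (rule measure_digits)
  also have "\<dots> = (\<Prod>l<N. \<Prod>q\<in>{q. q \<in> UNIV \<and> l < L q}. 1 / prefix_ratio q (digit l x))"
  proof (intro prod.cong refl)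
    fix l
    have "k \<in> {q. l < L q}" if "q \<in> {q. l < L q}" "k \<le> q" for k q
      using that antimonoD[OF L, of k q] by simp
    from prefix_sum_eq[OF digit_in[OF x] this]
    show "sum p (\<Lambda> \<inter> {j. \<forall>q\<in>{q. l < L q}. j q = digit l x q}) =
        (\<Prod>q\<in>{q. q \<in> UNIV \<and> l < L q}. 1 / prefix_ratio q (digit l x))"
      by (simp add: Int_def)
  qed
  also have "\<dots> = (\<Prod>q\<in>UNIV. \<Prod>l\<in>{l. l \<in> {..<N} \<and> l < L q}. 1 / prefix_ratio q (digit l x))"
    by (rule prod.swap_restrict) auto
  also have "\<dots> = (\<Prod>q\<in>UNIV. \<Prod>l<L q. 1 / prefix_ratio q (digit l x))"
  proof (intro prod.cong refl)
    fix q l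
    show "{l. l \<in> {..<N} \<and> l < L q} = {..<L q}" using N[of q] by auto
  qed
  finally show ?thesis .
qed

lemma measure_approx_cube_pos:
  assumes "x \<in> F" "antimono L" shows "0 < measure \<mu> (approx_cube x L)"
proof -
  have "0 < prefix_ratio q (digit l x)" for q l
    using prefix_ratio_ge1[OF digit_in[OF assms(1)], of q l] by linarith
  then show ?thesis using assms by (simp add: measure_approx_cube prod_pos)
qed

lemma measure_approx_cube_ratio:
  assumes x: "x \<in> F" and L: "antimono L" "antimono L'" and le: "\<And>q. L q \<le> L' q"
  shows "measure \<mu> (approx_cube x L) / measure \<mu> (approx_cube x L') =
         (\<Prod>q\<in>UNIV. \<Prod>l\<in>{L q..<L' q}. prefix_ratio q (digit l x))"
proof -
  have nz: "prefix_ratio q (digit l x) \<noteq> 0" for q l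
    using prefix_ratio_ge1[OF digit_in[OF x], of q l] by linarith
  have "(\<Prod>l<L q. 1 / prefix_ratio q (digit l x)) =
      (\<Prod>l<L' q. 1 / prefix_ratio q (digit l x)) * (\<Prod>l\<in>{L q..<L' q}. prefix_ratio q (digit l x))" for q
  proof -
    have "{..<L' q} = {..<L q} \<union> {L q..<L' q}" using le[of q] by auto
    then have "(\<Prod>l<L' q. 1 / prefix_ratio q (digit l x)) =
        (\<Prod>l<L q. 1 / prefix_ratio q (digit l x)) * (\<Prod>l\<in>{L q..<L' q}. 1 / prefix_ratio q (digit l x))"
      by (simp add: prod.union_disjoint ivl_disj_int)
    moreover have "(\<Prod>l\<in>{L q..<L' q}. 1 / prefix_ratio q (digit l x)) *
        (\<Prod>l\<in>{L q..<L' q}. prefix_ratio q (digit l x)) = 1"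
      using nz by (simp add: prod.distrib[symmetric])
    ultimately show ?thesis by (simp add: mult.assoc)
  qed
  then have "measure \<mu> (approx_cube x L) = measure \<mu> (approx_cube x L') *
      (\<Prod>q\<in>UNIV. \<Prod>l\<in>{L q..<L' q}. prefix_ratio q (digit l x))"
    using x L by (simp add: measure_approx_cube prod.distrib)
  then show ?thesis using measure_approx_cube_pos[OF x L(2)] by simp
qed

subsection \<open>Comparison with balls\<close>

lemma coordinate_shift:
  assumes "x \<in> F" shows "x $ q = (shift x $ q + first_digit x q) / n q"
proof -
  obtain i y where "i \<in> \<Lambda>" "y \<in> F" "x = sponge_map n i y" using assms by (rule F_cases)
  then show ?thesis by (simp add: first_digit_sponge_map shift_sponge_map) (simp add: sponge_map_def)
qed

lemma coordinate_diff:
  assumes x: "x \<in> F" and y: "y \<in> F" and eq: "\<And>k. k < l \<Longrightarrow> digit k x q = digit k y q"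
  shows "x $ q - y $ q = ((shift ^^ l) x $ q - (shift ^^ l) y $ q) / n q ^ l"
  using eq
proof (induction l)
  case (Suc l)
  let ?x = "(shift ^^ l) x" and ?y = "(shift ^^ l) y"
  have "first_digit ?x q = first_digit ?y q" using Suc.prems[of l] by (simp add: digit_def)
  then have "?x $ q - ?y $ q = (shift ?x $ q - shift ?y $ q) / n q"
    using coordinate_shift[OF funpow_shift_in[OF x], of l q] coordinate_shift[OF funpow_shift_in[OF y], of l q]
    by (simp add: diff_divide_distrib add_divide_distrib)
  moreover have "x $ q - y $ q = (?x $ q - ?y $ q) / n q ^ l" using Suc by simp
  ultimately show ?case by simp
qed simp

text \<open>The Euclidean norm is at most the sum of the coordinate distances, which is where the
  factor \<open>CARD('d)\<close> comes from.\<close>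

lemma approx_cube_subset_cball:
  assumes x: "x \<in> F" and L: "\<And>q. 1 / n q ^ L q \<le> R / CARD('d)"
  shows "approx_cube x L \<subseteq> cball x R"
proof
  fix y assume "y \<in> approx_cube x L"
  then have y: "y \<in> F" and eq: "\<And>q l. l < L q \<Longrightarrow> digit l x q = digit l y q"
    by (auto simp: approx_cube_def)
  have "\<bar>x $ q - y $ q\<bar> \<le> R / CARD('d)" for q
  proof -
    have "\<bar>(shift ^^ L q) x $ q - (shift ^^ L q) y $ q\<bar> \<le> 1"
      using F_bounds[OF funpow_shift_in[OF x], of "L q" q] F_bounds[OF funpow_shift_in[OF y], of "L q" q]
      by linarith
    then have "\<bar>x $ q - y $ q\<bar> \<le> 1 / n q ^ L q"
      using coordinate_diff[OF x y eq, of "L q" q] by (simp add: divide_right_mono)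
    then show ?thesis using L[of q] by linarith
  qed
  then have "(\<Sum>q\<in>UNIV. \<bar>(x - y) $ q\<bar>) \<le> (\<Sum>q\<in>(UNIV::'d set). R / CARD('d))"
    by (intro sum_mono) simp
  then have "norm (x - y) \<le> R"
    using norm_le_l1_cart[of "x - y"] by simp
  then show "y \<in> cball x R" by (simp add: dist_norm)
qed

text \<open>This is where separation enters geometrically: the first relevant disagreement of digits
  already forces a distance of at least \<open>1 / n q ^ Suc l\<close> in some constrained
  coordinate \<open>q\<close>.\<close>

lemma cball_subset_approx_cube:
  assumes x: "x \<in> F" and L: "antimono L" and r: "\<And>q l. l < L q \<Longrightarrow> r < 1 / n q ^ Suc l"
  shows "cball x r \<inter> F \<subseteq> approx_cube x L"
proof (rule subsetI, rule ccontr)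
  fix y assume "y \<in> cball x r \<inter> F" and notin: "y \<notin> approx_cube x L"
  then have y: "y \<in> F" and dist: "dist x y \<le> r" by auto
  define bad where "bad l \<longleftrightarrow> (\<exists>q. l < L q \<and> digit l x q \<noteq> digit l y q)" for l
  \<comment> \<open>The least bad position is taken over all coordinates together, because
    separation may occur in a coordinate \<open>q\<close> other than \<open>q0\<close> and the
    earlier digits must agree in that one.\<close>
  define l where "l = (LEAST l. bad l)"
  have "\<exists>l. bad l" using notin y by (force simp: bad_def approx_cube_def)
  then have "bad l" unfolding l_def by (rule LeastI_ex)
  then obtain q0 where q0: "l < L q0" "digit l x q0 \<noteq> digit l y q0" by (auto simp: bad_def)
  obtain q where q: "q \<le> q0" "1 < \<bar>int (digit l x q) - int (digit l y q)\<bar>"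
    using first_difference[OF digit_in[OF x] digit_in[OF y] q0(2)] by metis
  have lq: "l < L q" using q0(1) antimonoD[OF L q(1)] by simp
  have "digit k x q = digit k y q" if "k < l" for k
  proof -
    have "\<not> bad k" using not_less_Least that unfolding l_def by blast
    then show ?thesis using that lq by (auto simp: bad_def)
  qed
  then have d: "x $ q - y $ q = ((shift ^^ l) x $ q - (shift ^^ l) y $ q) / n q ^ l"
    by (rule coordinate_diff[OF x y])
  have "(shift ^^ l) z $ q = ((shift ^^ Suc l) z $ q + digit l z q) / n q" if "z \<in> F" for z
    using coordinate_shift[OF funpow_shift_in[OF that], of l q] by (simp add: digit_def)
  then have "x $ q - y $ q = (((shift ^^ Suc l) x $ q + digit l x q) -
      ((shift ^^ Suc l) y $ q + digit l y q)) / n q ^ Suc l"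
    unfolding d using x y by (simp add: diff_divide_distrib add_divide_distrib)
  moreover have "1 \<le> \<bar>((shift ^^ Suc l) x $ q + digit l x q) - ((shift ^^ Suc l) y $ q + digit l y q)\<bar>"
    by (intro digit_separation digit_in x y funpow_shift_in q(2))
  ultimately have "1 / n q ^ Suc l \<le> \<bar>x $ q - y $ q\<bar>"
    by (simp only: abs_divide) (simp add: divide_right_mono del: funpow.simps)
  also have "\<dots> \<le> dist x y"
    using component_le_norm_cart[of "x - y" q] by (simp add: dist_norm)
  finally show False using dist r[OF lq] by linarith
qed

section \<open>Digit counts at a given scale\<close>

text \<open>For positive \<open>t\<close> this is the least exponent with
  \<open>t \<le> n q ^ level t q\<close>; it is 0 for \<open>t \<le> 1\<close> by the truncation in
  \<open>nat\<close>.\<close>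

definition level :: "real \<Rightarrow> 'd \<Rightarrow> nat" where
  "level t q = nat \<lceil>log (n q) t\<rceil>"

lemma level_ge: "log (n q) t \<le> level t q"
  unfolding level_def by linarith

lemma level_less: "l < level t q \<Longrightarrow> real l < log (n q) t"
  unfolding level_def by linarith

lemma level_le: "1 \<le> t \<Longrightarrow> level t q \<le> log (n q) t + 1"
  unfolding level_def using zero_le_log_cancel_iff[OF n_gt1[of q], of t] by linarith

lemma power_level_ge: "0 < t \<Longrightarrow> t \<le> n q ^ level t q"
  using level_ge[of q t] n_gt1[of q] by (simp add: log_le_iff powr_realpow)

lemma power_level_less: "0 < t \<Longrightarrow> l < level t q \<Longrightarrow> real (n q ^ l) < t"
  using level_less[of l t q] n_gt1[of q] by (simp add: less_log_iff powr_realpow)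

lemma antimono_level:
  assumes "0 < t" shows "antimono (level t)"
proof
  fix q q' :: 'd assume "q \<le> q'"
  show "level t q' \<le> level t q"
  proof (cases "1 \<le> t")
    case True
    have "ln (n q) \<le> ln (n q')" "0 < ln (n q)"
      using n_mono[OF \<open>q \<le> q'\<close>] n_gt1[of q] n_gt1[of q'] by auto
    then have "log (n q') t \<le> log (n q) t"
      using True unfolding log_def by (intro divide_left_mono) auto
    then show ?thesis unfolding level_def by (intro nat_mono ceiling_mono)
  next
    \<comment> \<open>The comparison of the logarithms reverses for \<open>t < 1\<close>, but the
      level at \<open>q'\<close> is truncated to 0.\<close>
    case False
    then have "log (n q') t \<le> 0"
      using assms n_gt1[of q'] by simp
    then show ?thesis unfolding level_def by simp
  qed
qed

lemma level_mono: "0 < t \<Longrightarrow> t \<le> t' \<Longrightarrow> level t q \<le> level t' q"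
  unfolding level_def using n_gt1[of q] by (intro nat_mono ceiling_mono) simp

lemma approx_cube_level_subset:
  assumes x: "x \<in> F" and R: "0 < R"
  shows "approx_cube x (level (CARD('d) / R)) \<subseteq> cball x R"
proof (rule approx_cube_subset_cball[OF x])
  fix q
  have "CARD('d) / R \<le> n q ^ level (CARD('d) / R) q" using R by (intro power_level_ge) auto
  then show "1 / real (n q ^ level (CARD('d) / R) q) \<le> R / CARD('d)"
    using R n_gt1[of q] by (simp add: field_simps)
qed

lemma measure_cball_pos:
  assumes "x \<in> F" "0 < r" shows "0 < measure \<mu> (cball x r)"
proof -
  have "0 < measure \<mu> (approx_cube x (level (CARD('d) / r)))"
    using assms by (intro measure_approx_cube_pos antimono_level) auto
  also have "\<dots> \<le> measure \<mu> (cball x r)"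
    using approx_cube_level_subset[OF assms] by (intro finite_measure_mono) auto
  finally show ?thesis .
qed

subsection \<open>The extremal exponent\<close>

definition max_ratio :: "'d \<Rightarrow> real" where
  "max_ratio q = Max (prefix_ratio q ` \<Lambda>)"

definition top_exponent :: real where
  "top_exponent = (\<Sum>q\<in>UNIV. ln (max_ratio q) / ln (n q))"

lemma prefix_ratio_le_max: "i \<in> \<Lambda> \<Longrightarrow> prefix_ratio q i \<le> max_ratio q"
  unfolding max_ratio_def using finite_\<Lambda> by simp

lemma max_ratio_ge1: "1 \<le> max_ratio q"
  using \<Lambda>_nonempty prefix_ratio_ge1 prefix_ratio_le_max by (meson ex_in_conv order_trans)

lemma max_ratio_attained: "\<exists>i\<in>\<Lambda>. prefix_ratio q i = max_ratio q"
proof -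
  have "max_ratio q \<in> prefix_ratio q ` \<Lambda>"
    unfolding max_ratio_def using finite_\<Lambda> \<Lambda>_nonempty by (intro Max_in) auto
  then show ?thesis by auto
qed

lemma top_exponent_nonneg: "0 \<le> top_exponent"
  unfolding top_exponent_def
proof (intro sum_nonneg divide_nonneg_nonneg)
  fix q show "0 \<le> ln (max_ratio q)" "0 \<le> ln (real (n q))"
    using max_ratio_ge1[of q] n_gt1[of q] by simp_all
qed

text \<open>The larger ball is enclosed in a cube and the smaller one contains a cube. Each digit
  between the two cubes contributes at most \<open>max_ratio q\<close>, and there are
  \<open>log (n q) (R / r)\<close> of them up to a constant.\<close>

lemma cball_ratio_upper:
  assumes x: "x \<in> F" and r: "0 < r" "r < R"
  shows "measure \<mu> (cball x R) / measure \<mu> (cball x r) \<le>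
    (\<Prod>q\<in>UNIV. max_ratio q powr (log (n q) CARD('d) + 2)) * (R / r) powr top_exponent"
proof -
  \<comment> \<open>Rounding up may overshoot \<open>1 / R\<close>; with one digit fewer,
    \<open>cball_subset_approx_cube\<close> gets its strict inequality.\<close>
  define L where "L q = level (1 / R) q - 1" for q
  define L' where "L' = level (CARD('d) / r)"
  have R: "0 < R" using r by simp
  have card: "1 \<le> real CARD('d)" by (simp add: Suc_leI)
  have anti: "antimono L" "antimono L'"
    using antimono_level[of "1 / R"] antimono_level[of "CARD('d) / r"] r R
    by (auto simp: L_def L'_def monotone_def diff_le_mono)
  have "1 / R \<le> CARD('d) / r" using r R card by (intro frac_le) auto
  then have le: "L q \<le> L' q" for q
    using level_mono[of "1 / R" "CARD('d) / r" q] R by (simp add: L_def L'_def)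
  have "cball x R \<inter> F \<subseteq> approx_cube x L"
  proof (rule cball_subset_approx_cube[OF x anti(1)])
    fix q l assume "l < L q"
    then have "n q ^ Suc l < 1 / R" using R by (intro power_level_less) (auto simp: L_def)
    then show "R < 1 / real (n q ^ Suc l)"
      using R n_gt1[of q] by (simp add: field_simps)
  qed
  then have "measure \<mu> (cball x R) \<le> measure \<mu> (approx_cube x L)"
    by (intro measure_mono_F borel_approx_cube) auto
  moreover have "measure \<mu> (approx_cube x L') \<le> measure \<mu> (cball x r)"
    using approx_cube_level_subset[OF x r(1)] unfolding L'_def
    by (intro finite_measure_mono) auto
  ultimately have "measure \<mu> (cball x R) / measure \<mu> (cball x r) \<le>
      measure \<mu> (approx_cube x L) / measure \<mu> (approx_cube x L')"
    using measure_approx_cube_pos[OF x anti(2)] by (intro frac_le) auto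
  also have "\<dots> = (\<Prod>q\<in>UNIV. \<Prod>l\<in>{L q..<L' q}. prefix_ratio q (digit l x))"
    by (rule measure_approx_cube_ratio[OF x anti le])
  also have "\<dots> \<le> (\<Prod>q\<in>UNIV. max_ratio q powr (log (n q) (R / r) + (log (n q) CARD('d) + 2)))"
  proof (intro prod_mono conjI prod_nonneg)
    fix q l
    show "0 \<le> prefix_ratio q (digit l x)"
      using prefix_ratio_ge1[OF digit_in[OF x], of q l] by linarith
  next
    fix q
    have log_card: "0 \<le> log (n q) CARD('d)" using card n_gt1[of q] by simp
    have log_ratio: "0 \<le> log (n q) (R / r)" using r n_gt1[of q] by simp
    \<comment> \<open>The 2 pays for the rounding in \<open>L'\<close> and for the digit dropped in
      \<open>L\<close>. A level truncated to 0 is treated apart, since it can exceed the logarithm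
      by more than 1.\<close>
    have bound: "L' q - L q \<le> log (n q) (R / r) + (log (n q) CARD('d) + 2)"
    proof (cases "L' q")
      case 0
      then show ?thesis using log_card log_ratio by simp
    next
      case (Suc k)
      then have "real k < log (n q) (CARD('d) / r)"
        unfolding L'_def by (intro level_less) simp
      then have "real (L' q) < log (n q) (CARD('d) / r) + 1" using Suc by simp
      moreover have "log (n q) (1 / R) - 1 \<le> L q"
        using level_ge[of q "1 / R"] unfolding L_def by linarith
      moreover have "log (n q) (CARD('d) / r) - log (n q) (1 / R) = log (n q) (R / r) + log (n q) CARD('d)"
        using r R n_gt1[of q] by (simp add: log_divide)
      ultimately show ?thesis using le[of q] by (simp add: of_nat_diff)
    qed
    have "(\<Prod>l\<in>{L q..<L' q}. prefix_ratio q (digit l x)) \<le> (\<Prod>l\<in>{L q..<L' q}. max_ratio q)"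
      using prefix_ratio_ge1[OF digit_in[OF x], of q]
      by (intro prod_mono) (auto intro: prefix_ratio_le_max digit_in x order_trans[of 0 1])
    also have "\<dots> = max_ratio q powr (L' q - L q)"
      using max_ratio_ge1[of q] by (simp add: powr_realpow)
    also have "\<dots> \<le> max_ratio q powr (log (n q) (R / r) + (log (n q) CARD('d) + 2))"
      using max_ratio_ge1[of q] bound by (intro powr_mono) auto
    finally show "(\<Prod>l\<in>{L q..<L' q}. prefix_ratio q (digit l x)) \<le> \<dots>" .
  qed
  also have "\<dots> = (\<Prod>q\<in>UNIV. max_ratio q powr (log (n q) CARD('d) + 2)) * (R / r) powr top_exponent"
    unfolding top_exponent_def using r R max_ratio_ge1 n_ge2
    by (intro prod_power_log_eq) (auto intro: less_le_trans[of 0 1])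
  finally show ?thesis .
qed

text \<open>Every real \<open>s\<close> above \<open>top_exponent\<close> is admissible; taking it
  strictly larger also secures the required \<open>0 < s\<close>.\<close>

lemma assouad_dim_le: "assouad_dim F \<mu> \<le> ereal top_exponent"
proof (rule dense_ge)
  fix z assume z: "ereal top_exponent < z"
  let ?C = "\<Prod>q\<in>UNIV. max_ratio q powr (log (n q) CARD('d) + 2)"
  show "assouad_dim F \<mu> \<le> z"
  proof (cases z)
    case (real s)
    have s: "top_exponent < s" using z real by simp
    have C: "0 < ?C"
    proof (intro prod_pos ballI)
      fix q show "0 < max_ratio q powr (log (n q) CARD('d) + 2)"
        using max_ratio_ge1[of q] by simp
    qed
    have "measure \<mu> (cball x R) / measure \<mu> (cball x r) \<le> ?C * (R / r) powr s"
      if "x \<in> F" "0 < r" "r < R" for x r R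
    proof -
      have "(R / r) powr top_exponent \<le> (R / r) powr s"
        using that s by (intro powr_mono) auto
      then show ?thesis
        using cball_ratio_upper[OF that] C by (meson less_imp_le mult_left_mono order_trans)
    qed
    moreover have "0 < s" using s top_exponent_nonneg by linarith
    ultimately show ?thesis
      unfolding assouad_dim_def real using C by (intro Inf_lower imageI) blast
  qed (use z in auto)
qed

subsection \<open>Recurrence of extremal digit blocks\<close>

definition digit_block :: "('d \<Rightarrow> nat) \<Rightarrow> real \<Rightarrow> 'd \<Rightarrow> nat set" where
  "digit_block N u q = {level u q..<level u q + N q}"

text \<open>At scale \<open>exp K\<close> the level in coordinate \<open>q\<close> is about
  \<open>K / ln (n q)\<close>. These rates are distinct, so for large \<open>K\<close> the gaps
  between levels exceed all block lengths, and all levels exceed \<open>b\<close>.\<close>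

lemma exists_disjoint_scale:
  obtains u where "1 \<le> u" "\<And>q. b \<le> level u q" "\<And>q q'. q < q' \<Longrightarrow> level u q' + N q' \<le> level u q"
proof -
  \<comment> \<open>The growth rate in \<open>K\<close> of the gap between the levels of
    \<open>q\<close> and \<open>q'\<close>; below, the 1 in \<open>N q' + 1\<close> absorbs the
    rounding of the lower level.\<close>
  define c where "c q q' = 1 / ln (real (n q)) - 1 / ln (real (n q'))" for q q'
  have ln_pos: "0 < ln (real (n q))" for q using n_gt1[of q] by simp
  have c: "0 < c q q'" if "q < q'" for q q'
    using n_strict_mono[OF that] n_gt1[of q] n_gt1[of q'] unfolding c_def
    by (auto intro!: divide_strict_left_mono)
  have "\<forall>\<^sub>F K in at_top. 0 \<le> K \<and> (\<forall>q\<in>UNIV. b * ln (n q) \<le> K) \<and>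
      (\<forall>q\<in>UNIV. \<forall>q'\<in>UNIV. (N q' + 1) / c q q' \<le> K)"
    by (intro eventually_conj eventually_ball_finite ballI eventually_ge_at_top) auto
  then obtain K where K: "0 \<le> K" "\<And>q. b * ln (n q) \<le> K" "\<And>q q'. (N q' + 1) / c q q' \<le> K"
    unfolding eventually_at_top_linorder by blast
  have log_exp: "log (n q) (exp K) = K / ln (n q)" for q by (simp add: log_def)
  show thesis
  proof (rule that[of "exp K"])
    show "1 \<le> exp K" using K by simp
    show "b \<le> level (exp K) q" for q
    proof -
      have "real b \<le> K / ln (n q)" using K(2)[of q] ln_pos[of q] by (simp add: field_simps)
      then show ?thesis using level_ge[of q "exp K"] by (simp add: log_exp)
    qed
    show "level (exp K) q' + N q' \<le> level (exp K) q" if "q < q'" for q q'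
    proof -
      have "N q' + 1 \<le> K * c q q'" using K(3)[of q' q] c[OF that] by (simp add: field_simps)
      also have "\<dots> = K / ln (n q) - K / ln (n q')" by (simp add: c_def field_simps)
      finally show ?thesis
        using level_ge[of q "exp K"] level_le[of "exp K" q'] K(1) by (simp add: log_exp)
    qed
  qed
qed

text \<open>Scales are chosen greedily: the blocks of each new scale start no earlier than all
  blocks of the preceding scales have ended.\<close>

lemma exists_disjoint_blocks:
  obtains u where "\<And>k. 1 \<le> u k" "disjoint_family (\<lambda>(k::nat, q). digit_block N (u k) q)"
proof -
  have "\<exists>u. 1 \<le> u \<and> (\<forall>q. b \<le> level u q) \<and> (\<forall>q q'. q < q' \<longrightarrow> level u q' + N q' \<le> level u q)" for b
    by (rule exists_disjoint_scale[of b N]) blast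
  then have "\<exists>U. \<forall>b. 1 \<le> U b \<and> (\<forall>q. b \<le> level (U b) q) \<and>
      (\<forall>q q'. q < q' \<longrightarrow> level (U b) q' + N q' \<le> level (U b) q)"
    by (intro choice allI)
  then obtain U where U: "\<And>b. 1 \<le> U b" "\<And>b q. b \<le> level (U b) q"
      "\<And>b q q'. q < q' \<Longrightarrow> level (U b) q' + N q' \<le> level (U b) q"
    by blast
  \<comment> \<open>\<open>B b\<close> bounds the ends of all blocks at the scale chosen for
    \<open>b\<close>; iterating it gives the successive starting bounds \<open>s k\<close>.\<close>
  define B where "B b = Max (range (\<lambda>q. level (U b) q + N q))" for b
  have B: "level (U b) q + N q \<le> B b" for b q unfolding B_def by simp
  define s where "s k = (B ^^ k) 0" for k
  have "incseq s"
  proof (rule incseq_SucI)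
    fix k show "s k \<le> s (Suc k)"
      using B[of "s k" undefined] U(2)[of "s k" undefined] by (simp add: s_def)
  qed
  have sep: "level (U (s k)) q + N q \<le> level (U (s k')) q'" if "k < k'" for k k' q q'
  proof -
    have "level (U (s k)) q + N q \<le> s (Suc k)" using B by (simp add: s_def)
    also have "\<dots> \<le> s k'" using \<open>incseq s\<close> that by (simp add: incseqD)
    also have "\<dots> \<le> level (U (s k')) q'" by (rule U(2))
    finally show ?thesis .
  qed
  show thesis
  proof (rule that[of "\<lambda>k. U (s k)"])
    show "1 \<le> U (s k)" for k by (rule U(1))
    have "digit_block N (U (s k)) q \<inter> digit_block N (U (s k')) q' = {}" if ne: "(k, q) \<noteq> (k', q')" for k q k' q'
    proof -
      consider "k < k'" | "k' < k" | "k = k'" "q < q'" | "k = k'" "q' < q"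
        using ne less_linear[of k k'] less_linear[of q q'] by auto
      then show ?thesis
        using sep[of k k' q q'] sep[of k' k q' q] U(3)[of q q' "s k"] U(3)[of q' q "s k"]
        by cases (auto simp: digit_block_def)
    qed
    then show "disjoint_family (\<lambda>(k, q). digit_block N (U (s k)) q)"
      by (auto simp: disjoint_family_on_def)
  qed
qed

text \<open>Along scales with disjoint blocks the events \<open>E k\<close> are independent, and all
  have the same probability \<open>c > 0\<close> because the block lengths do not depend on the
  scale. Missing the first \<open>m\<close> of them has probability \<open>(1 - c) ^ m\<close>,
  which tends to 0.\<close>

lemma AE_block_pattern:
  assumes a: "\<And>q. a q \<in> \<Lambda>"
  shows "AE x in \<mu>. \<exists>u\<ge>1. \<forall>q. \<forall>l\<in>digit_block N u q. digit l x = a q"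
proof -
  obtain u where u: "\<And>k. 1 \<le> u k" and disj: "disjoint_family (\<lambda>(k::nat, q). digit_block N (u k) q)"
    using exists_disjoint_blocks[of N] by blast
  define E where "E k = {x \<in> F. \<forall>q. \<forall>l\<in>digit_block N (u k) q. digit l x = a q}" for k
  define c where "c = (\<Prod>q\<in>UNIV. p (a q) ^ N q)"
  have c_pos: "0 < c" unfolding c_def by (intro prod_pos) (simp add: a p_pos)
  have joint: "measure \<mu> {x \<in> F. \<forall>k\<in>J. x \<in> E k} = c ^ card J" if "finite J" for J
  proof -
    have "{x \<in> F. \<forall>k\<in>J. x \<in> E k} =
        {x \<in> F. \<forall>z\<in>J \<times> UNIV. \<forall>l\<in>(\<lambda>(k, q). digit_block N (u k) q) z. digit l x = a (snd z)}"
      by (auto simp: E_def)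
    also have "measure \<mu> \<dots> =
        (\<Prod>z\<in>J \<times> UNIV. p (a (snd z)) ^ card ((\<lambda>(k, q). digit_block N (u k) q) z))"
      using that a disj
      by (intro measure_digit_blocks) (auto simp: digit_block_def intro: disjoint_family_on_mono)
    also have "\<dots> = (\<Prod>k\<in>J. \<Prod>q\<in>UNIV. p (a q) ^ N q)"
      by (subst prod.cartesian_product) (auto simp: digit_block_def intro!: prod.cong)
    finally show ?thesis by (simp add: c_def)
  qed
  have borel_E: "E k \<in> sets borel" for k
  proof -
    have "E k = (\<Inter>q. {x \<in> F. \<forall>l\<in>digit_block N (u k) q. digit l x = a q})"
      by (auto simp: E_def)
    also have "\<dots> \<in> sets borel"
      by (intro sets.finite_INT borel_digits_pattern) (auto simp: digit_block_def)
    finally show ?thesis .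
  qed
  \<comment> \<open>Carrying the positive events \<open>J\<close> along lets the complements be removed one at a time.\<close>
  define H where "H m J = {x \<in> F. (\<forall>k<m. x \<notin> E k) \<and> (\<forall>k\<in>J. x \<in> E k)}" for m :: nat and J
  have borel_H: "H m J \<in> sets borel" if "finite J" for m J
  proof -
    have "H m J = F - (\<Union>k\<in>{..<m}. E k) - (\<Union>k\<in>J. F - E k)"
      by (auto simp: H_def)
    also have "\<dots> \<in> sets borel"
      using that borel_E borel_F by (intro sets.Diff sets.finite_UN) auto
    finally show ?thesis .
  qed
  have measure_H: "measure \<mu> (H m J) = (1 - c) ^ m * c ^ card J"
    if "finite J" "J \<inter> {..<m} = {}" for m J
    using that
  proof (induction m arbitrary: J)
    case 0
    then show ?case using joint[of J] by (simp add: H_def)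
  next
    case (Suc m)
    have "m \<notin> J" using Suc.prems by auto
    have "H (Suc m) J = H m J - H m (insert m J)" by (auto simp: H_def less_Suc_eq)
    moreover have "H m (insert m J) \<subseteq> H m J" by (auto simp: H_def)
    ultimately have "measure \<mu> (H (Suc m) J) = measure \<mu> (H m J) - measure \<mu> (H m (insert m J))"
      using Suc.prems borel_H by (simp add: finite_measure_Diff)
    also have "\<dots> = (1 - c) ^ m * c ^ card J - (1 - c) ^ m * c ^ card (insert m J)"
      using Suc.prems by (subst (1 2) Suc.IH) auto
    also have "\<dots> = (1 - c) ^ Suc m * c ^ card J"
      using Suc.prems \<open>m \<notin> J\<close> by (simp add: algebra_simps)
    finally show ?case .
  qed
  let ?Z = "F - (\<Union>k. E k)"
  have Z: "?Z \<in> sets borel" using borel_E borel_F by auto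
  have "measure \<mu> ?Z \<le> (1 - c) ^ m" for m
  proof -
    have "?Z \<subseteq> H m {}" by (auto simp: H_def)
    then have "measure \<mu> ?Z \<le> measure \<mu> (H m {})"
      using borel_H[of "{}" m] by (intro finite_measure_mono) auto
    then show ?thesis using measure_H[of "{}" m] by simp
  qed
  moreover have "(\<lambda>m. (1 - c) ^ m) \<longlonglongrightarrow> 0"
  proof (rule LIMSEQ_realpow_zero)
    show "0 \<le> 1 - c" using joint[of "{0}"] prob_le_1[of "{x \<in> F. \<forall>k\<in>{0}. x \<in> E k}"] by simp
  qed (use c_pos in simp)
  ultimately have "measure \<mu> ?Z \<le> 0" by (intro LIMSEQ_le_const) auto
  then have "emeasure \<mu> ?Z = 0" by (simp add: emeasure_eq_measure measure_le_0_iff)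
  then have "?Z \<in> null_sets \<mu>" using Z by (simp add: null_sets_def)
  then have "AE x in \<mu>. x \<notin> ?Z" by (rule AE_not_in)
  with AE_F show ?thesis
  proof eventually_elim
    case (elim x)
    then obtain k where "x \<in> E k" by blast
    then show ?case using u[of k] by (auto simp: E_def)
  qed
qed

section \<open>Lower bound for the pointwise dimension\<close>

text \<open>The inclusions are reversed compared with the upper bound: the larger ball contains a
  cube, the smaller one lies in a cube up to points outside \<open>F\<close>. All digits between the
  cubes are extremal, so the ratio is maximal up to rounding.\<close>

lemma pattern_ratio_lower:
  fixes t :: real
  assumes x: "x \<in> F" and t: "1 \<le> t" and u: "1 \<le> u"
    and N: "\<And>q. N q = nat \<lfloor>log (n q) t\<rfloor>"
    and a: "\<And>q. prefix_ratio q (a q) = max_ratio q"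
    and pattern: "\<And>q l. l \<in> digit_block N u q \<Longrightarrow> digit l x = a q"
  obtains r R where "0 < r" "r < R" "R / r = real CARD('d) * (real (Max (range n)) + 1) * t"
    "(\<Prod>q\<in>UNIV. max_ratio q powr - 1) * t powr top_exponent \<le>
       measure \<mu> (cball x R) / measure \<mu> (cball x r)"
proof -
  define R where "R = CARD('d) / u"
  \<comment> \<open>Rounding up in \<open>level u\<close> costs at most a factor \<open>n q\<close>,
    hence at most the maximum of \<open>n\<close>; the added 1 makes the inequality strict. The
    floor in \<open>N\<close> costs nothing here.\<close>
  define r where "r = 1 / (u * t * (real (Max (range n)) + 1))"
  define L' where "L' q = level u q + N q" for q
  have card: "1 \<le> real CARD('d)" by (simp add: Suc_leI)
  have r: "0 < r" using t u by (simp add: r_def)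
  have Rr: "R / r = real CARD('d) * (real (Max (range n)) + 1) * t" using t u by (simp add: R_def r_def algebra_simps)
  have "1 * 2 * 1 \<le> real CARD('d) * (real (Max (range n)) + 1) * t"
  proof (intro mult_mono)
    show "2 \<le> real (Max (range n)) + 1"
    proof -
      have "n undefined \<le> Max (range n)" by (rule Max_ge) auto
      then show ?thesis using n_ge2[of undefined] by linarith
    qed
  qed (use card t in auto)
  then have "1 < R / r" unfolding Rr by linarith
  then have "r < R" using r by simp
  have log_t: "0 \<le> log (n q) t" for q using t n_gt1[of q] by simp
  have N_le: "real (N q) \<le> log (n q) t" and N_ge: "log (n q) t - 1 \<le> real (N q)" for q
  proof -
    have "real (N q) = \<lfloor>log (n q) t\<rfloor>" using log_t[of q] by (simp add: N)
    then show "real (N q) \<le> log (n q) t" "log (n q) t - 1 \<le> real (N q)" by linarith+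
  qed
  have N_anti: "N q' \<le> N q" if "q \<le> q'" for q q'
  proof -
    have "ln (n q) \<le> ln (n q')" "0 < ln (n q)"
      using n_mono[OF that] n_gt1[of q] n_gt1[of q'] by auto
    then have "log (n q') t \<le> log (n q) t"
      using t unfolding log_def by (intro divide_left_mono) auto
    then show ?thesis unfolding N by (intro nat_mono floor_mono)
  qed
  have anti: "antimono (level u)" "antimono L'"
    using antimono_level[of u] u N_anti by (auto simp: L'_def monotone_def add_mono)
  have "approx_cube x (level u) \<subseteq> cball x R"
    using approx_cube_level_subset[OF x, of R] u by (simp add: R_def)
  then have "measure \<mu> (approx_cube x (level u)) \<le> measure \<mu> (cball x R)"
    by (intro finite_measure_mono) auto
  moreover have "cball x r \<inter> F \<subseteq> approx_cube x L'"
  proof (rule cball_subset_approx_cube[OF x anti(2)])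
    fix q l assume l: "l < L' q"
    have n1: "1 \<le> real (n q)" using n_gt1[of q] by simp
    have "real (n q) ^ level u q \<le> n q * u"
    proof (cases "level u q")
      case 0
      then show ?thesis using n1 u mult_mono[of 1 "real (n q)" 1 u] by simp
    next
      case (Suc k)
      then have "real (n q) ^ k < u" using u power_level_less[of u k q] by simp
      then show ?thesis using Suc n1 by simp
    qed
    moreover have "real (n q) ^ N q \<le> t"
      using N_le[of q] n_gt1[of q] t by (simp add: le_log_iff powr_realpow)
    ultimately have "real (n q) ^ L' q \<le> (n q * u) * t"
      unfolding L'_def power_add using u t by (intro mult_mono) auto
    moreover have "real (n q) ^ Suc l \<le> real (n q) ^ L' q"
      using l n1 by (intro power_increasing) auto
    moreover have "(n q * u) * t < u * t * (real (Max (range n)) + 1)"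
    proof -
      have "n q \<le> Max (range n)" by (rule Max_ge) auto
      then have "real (n q) < real (Max (range n)) + 1" by linarith
      then have "(u * t) * real (n q) < (u * t) * (real (Max (range n)) + 1)"
        using u t by (intro mult_strict_left_mono) auto
      then show ?thesis by (simp add: mult_ac)
    qed
    ultimately have "real (n q) ^ Suc l < u * t * (real (Max (range n)) + 1)" by linarith
    then have "1 / (u * t * (real (Max (range n)) + 1)) < 1 / real (n q) ^ Suc l"
      using n_gt1[of q] u t by (intro divide_strict_left_mono mult_pos_pos) auto
    then show "r < 1 / real (n q ^ Suc l)" unfolding r_def by simp
  qed
  then have "measure \<mu> (cball x r) \<le> measure \<mu> (approx_cube x L')"
    by (intro measure_mono_F borel_approx_cube) auto
  ultimately have "measure \<mu> (approx_cube x (level u)) / measure \<mu> (approx_cube x L') \<le>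
      measure \<mu> (cball x R) / measure \<mu> (cball x r)"
    using measure_cball_pos[OF x r] by (intro frac_le) auto
  moreover have "measure \<mu> (approx_cube x (level u)) / measure \<mu> (approx_cube x L') =
      (\<Prod>q\<in>UNIV. \<Prod>l\<in>{level u q..<L' q}. prefix_ratio q (digit l x))"
    by (rule measure_approx_cube_ratio[OF x anti]) (simp add: L'_def)
  moreover have "\<dots> = (\<Prod>q\<in>UNIV. max_ratio q ^ N q)"
  proof (intro prod.cong refl)
    fix q
    have "(\<Prod>l\<in>{level u q..<L' q}. prefix_ratio q (digit l x)) = (\<Prod>l\<in>{level u q..<L' q}. max_ratio q)"
      using pattern[of _ q] by (intro prod.cong refl) (simp add: a L'_def digit_block_def)
    then show "(\<Prod>l\<in>{level u q..<L' q}. prefix_ratio q (digit l x)) = max_ratio q ^ N q"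
      by (simp add: L'_def)
  qed
  \<comment> \<open>The floor in \<open>N q\<close> loses at most one factor
    \<open>max_ratio q\<close>; this is the offset -1 passed to
    \<open>prod_power_log_eq\<close>.\<close>
  moreover have "(\<Prod>q\<in>UNIV. max_ratio q powr (log (n q) t + - 1)) \<le> (\<Prod>q\<in>UNIV. max_ratio q ^ N q)"
  proof (intro prod_mono conjI)
    fix q
    have "max_ratio q powr (log (n q) t + - 1) \<le> max_ratio q powr real (N q)"
      using max_ratio_ge1[of q] N_ge[of q] by (intro powr_mono) auto
    then show "max_ratio q powr (log (n q) t + - 1) \<le> max_ratio q ^ N q"
      using max_ratio_ge1[of q] by (simp add: powr_realpow)
  qed simp
  moreover have "(\<Prod>q\<in>UNIV. max_ratio q powr (log (n q) t + - 1)) =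
      (\<Prod>q\<in>UNIV. max_ratio q powr - 1) * t powr top_exponent"
    unfolding top_exponent_def using t max_ratio_ge1 n_ge2
    by (intro prod_power_log_eq) (auto intro: less_le_trans[of 0 1])
  ultimately have "(\<Prod>q\<in>UNIV. max_ratio q powr - 1) * t powr top_exponent \<le>
      measure \<mu> (cball x R) / measure \<mu> (cball x r)"
    by simp
  then show thesis by (rule that[OF r \<open>r < R\<close> Rr])
qed

text \<open>An admissible \<open>s\<close> below \<open>top_exponent\<close> would keep
  \<open>t powr (top_exponent - s)\<close> bounded along the patterns. Integer \<open>t\<close>
  suffice for the contradiction, so only countably many null sets are discarded.\<close>

lemma AE_pointwise_assouad_dim_ge: "AE x in \<mu>. ereal top_exponent \<le> pointwise_assouad_dim \<mu> x"
proof -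
  obtain a where a: "\<And>q. a q \<in> \<Lambda>" "\<And>q. prefix_ratio q (a q) = max_ratio q"
    using max_ratio_attained by metis
  define N where "N k q = nat \<lfloor>log (n q) (Suc k)\<rfloor>" for k q
  have "AE x in \<mu>. \<forall>k. \<exists>u\<ge>1. \<forall>q. \<forall>l\<in>digit_block (N k) u q. digit l x = a q"
    unfolding AE_all_countable by (intro allI AE_block_pattern a)
  with AE_F show ?thesis
  proof eventually_elim
    case (elim x)
    define K where "K = real CARD('d) * (real (Max (range n)) + 1)"
    define c where "c = (\<Prod>q\<in>UNIV. max_ratio q powr - 1)"
    have K: "0 < K" by (simp add: K_def)
    have c: "0 < c" unfolding c_def
    proof (intro prod_pos ballI)
      fix q show "0 < max_ratio q powr - 1" using max_ratio_ge1[of q] by simp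
    qed
    have "top_exponent \<le> s"
      if C: "0 < C" and bound: "\<And>r R. 0 < r \<Longrightarrow> r < R \<Longrightarrow>
        measure \<mu> (cball x R) / measure \<mu> (cball x r) \<le> C * (R / r) powr s" for s C
    proof (rule ccontr)
      assume "\<not> top_exponent \<le> s"
      then have e: "0 < top_exponent - s" by simp
      define B where "B = C * K powr s / c"
      have le_B: "real (Suc k) powr (top_exponent - s) \<le> B" for k
      proof -
        obtain u where u: "1 \<le> u" "\<And>q l. l \<in> digit_block (N k) u q \<Longrightarrow> digit l x = a q"
          using elim(2) by blast
        obtain r R where rR: "0 < r" "r < R" "R / r = K * Suc k"
            "c * Suc k powr top_exponent \<le> measure \<mu> (cball x R) / measure \<mu> (cball x r)"
          unfolding c_def K_def
          by (rule pattern_ratio_lower[where t = "real (Suc k)" and N = "N k", OF elim(1) _ u(1) N_def a(2) u(2)]) auto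
        have "c * Suc k powr top_exponent \<le> C * (K * Suc k) powr s"
          using bound[OF rR(1,2)] rR(3,4) by simp
        also have "\<dots> = C * K powr s * Suc k powr s"
          using K by (simp add: powr_mult)
        finally show ?thesis using c by (simp add: B_def powr_diff field_simps)
      qed
      have "0 < B" using C K c by (simp add: B_def)
      obtain k where k: "(B + 1) powr (1 / (top_exponent - s)) < real k"
        using reals_Archimedean2 by blast
      have "B + 1 = ((B + 1) powr (1 / (top_exponent - s))) powr (top_exponent - s)"
        using \<open>0 < B\<close> e by (simp add: powr_powr)
      also have "\<dots> \<le> real (Suc k) powr (top_exponent - s)"
        using k e by (intro powr_mono2) auto
      finally show False using le_B[of k] by simp
    qed
    then show ?case
      unfolding pointwise_assouad_dim_def by (intro Inf_greatest) auto
  qed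
qed

section \<open>Comparison of the two dimensions\<close>

text \<open>A constant uniform over \<open>F\<close> serves at each of its points, so the pointwise
  infimum runs over a larger set of exponents.\<close>

lemma pointwise_assouad_dim_le:
  assumes "x \<in> F" shows "pointwise_assouad_dim \<mu> x \<le> assouad_dim F \<mu>"
  unfolding pointwise_assouad_dim_def assouad_dim_def
  using assms by (intro Inf_superset_mono image_mono) blast

lemma AE_pointwise_assouad_dim_eq:
  "AE x in \<mu>. pointwise_assouad_dim \<mu> x = assouad_dim F \<mu>"
  using AE_F AE_pointwise_assouad_dim_ge
proof eventually_elim
  case (elim x)
  then show ?case
    \<comment> \<open>The chain pointwise, global, \<open>top_exponent\<close>, pointwise closes up;
      only its last inequality is restricted to almost every point of \<open>F\<close>.\<close>
    using pointwise_assouad_dim_le[OF elim(1)] assouad_dim_le by (meson order_antisym order_trans)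
qed

end

theorem theorem6p4:
  fixes n :: "'d::{finite,linorder} \<Rightarrow> nat"
    and \<Lambda> :: "('d \<Rightarrow> nat) set"
    and p :: "('d \<Rightarrow> nat) \<Rightarrow> real"
    and F :: "(real ^ 'd::{finite,linorder}) set"
    and \<mu> :: "(real ^ 'd::{finite,linorder}) measure"
  assumes "sponge_digits n \<Lambda>"
    and "is_sponge n \<Lambda> F"
    and "\<forall>i\<in>\<Lambda>. 0 < p i \<and> p i < 1"
    and "(\<Sum>i\<in>\<Lambda>. p i) = 1"
    and "is_self_affine_measure n \<Lambda> p F \<mu>"
    and "very_strong_separation \<Lambda>"
  shows "AE x\<in>F in \<mu>. pointwise_assouad_dim \<mu> x = assouad_dim F \<mu>"
proof -
  interpret self_affine_sponge n \<Lambda> p F \<mu>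
    by unfold_locales (use assms in blast)+
  show ?thesis using AE_pointwise_assouad_dim_eq by eventually_elim simp
qed

end
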